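(* Let $n \geq 6$ and let $G = CS_{5,n-5}$ be the cycle-star graph with cycle length $k=5$ and $n-k \geq 1$ pendant vertices. Then $es(G) = n-2$ if $n = 6$, and $es(G) = n-3$ if $n \geq 7$.
   Context: For integers $k \geq 3$ and $n > k$, the cycle-star graph $CS_{k,n-k}$ is the simple graph on $n$ vertices consisting of a cycle of length $k$ together with $n-k$ additional vertices of degree one (leaves), all adjacent to the same single vertex of the cycle. For a simple graph $G$, a vertex $k$-labeling is a map $\phi: V(G) \to \{1,2,\ldots,k\}$; the weight of an edge $uv$ is $w_\phi(uv) = \phi(u)+\phi(v)$. The labeling is an edge irregular $k$-labeling if distinct edges have distinct weights. The edge irregularity strength $es(G)$ is the minimum $k$ for which $G$ admits an edge irregular $k$-labeling. *)

theory Defs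
  imports Main "HOL-Library.FuncSet"
begin

text \<open>
  A simple graph is given by its vertex set \<open>V\<close> and its set \<open>E\<close> of edges, an edge being a
  two-element set of vertices.
\<close>

definition simple_graph :: "'a set \<Rightarrow> 'a set set \<Rightarrow> bool" where
  "simple_graph V E \<longleftrightarrow> finite V \<and> (\<forall>e\<in>E. e \<subseteq> V \<and> card e = 2)"

definition vertex_labeling :: "'a set \<Rightarrow> nat \<Rightarrow> ('a \<Rightarrow> nat) \<Rightarrow> bool" where
  "vertex_labeling V k \<phi> \<longleftrightarrow> \<phi> \<in> V \<rightarrow> {1..k}"

definition edge_weight :: "('a \<Rightarrow> nat) \<Rightarrow> 'a set \<Rightarrow> nat" where
  "edge_weight \<phi> e = (\<Sum>v\<in>e. \<phi> v)"

lemma edge_weight_doubleton: "u \<noteq> v \<Longrightarrow> edge_weight \<phi> {u, v} = \<phi> u + \<phi> v"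
  by (simp add: edge_weight_def)

definition edge_irregular_labeling ::
    "'a set \<Rightarrow> 'a set set \<Rightarrow> nat \<Rightarrow> ('a \<Rightarrow> nat) \<Rightarrow> bool" where
  "edge_irregular_labeling V E k \<phi> \<longleftrightarrow> vertex_labeling V k \<phi> \<and> inj_on (edge_weight \<phi>) E"

definition edge_irregularity_strength :: "'a set \<Rightarrow> 'a set set \<Rightarrow> nat" where
  "edge_irregularity_strength V E = (LEAST k. \<exists>\<phi>. edge_irregular_labeling V E k \<phi>)"

text \<open>
  \<open>cycle_star k m V E\<close>: the graph \<open>(V, E)\<close> is a copy of the cycle-star graph with cycle length
  \<open>k\<close> and \<open>m\<close> leaves, hence with \<open>k + m\<close> vertices. The map \<open>c\<close> enumerates the cycle, starting
  at the vertex that carries the leaves \<open>L\<close>.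
\<close>

definition cycle_star :: "nat \<Rightarrow> nat \<Rightarrow> 'a set \<Rightarrow> 'a set set \<Rightarrow> bool" where
  "cycle_star k m V E \<longleftrightarrow> 3 \<le> k \<and> 0 < m \<and>
     (\<exists>c L. inj_on c {..<k} \<and> finite L \<and> card L = m \<and> c ` {..<k} \<inter> L = {} \<and>
        V = c ` {..<k} \<union> L \<and>
        E = {{c i, c (Suc i mod k)} | i. i < k} \<union> {{c 0, l} | l. l \<in> L})"

lemma cycle_star_simple_graph:
  assumes "cycle_star k m V E"
  shows "simple_graph V E" and "card V = k + m"
proof -
  from assms obtain c L where k: "3 \<le> k" and c: "inj_on c {..<k}" and L: "finite L" "card L = m"
    and disj: "c ` {..<k} \<inter> L = {}" and V: "V = c ` {..<k} \<union> L"
    and E: "E = {{c i, c (Suc i mod k)} | i. i < k} \<union> {{c 0, l} | l. l \<in> L}"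
    unfolding cycle_star_def by blast
  have ne: "c i \<noteq> c (Suc i mod k)" if "i < k" for i
  proof -
    have "i \<noteq> Suc i mod k" "Suc i mod k < k"
      using that k by (auto simp: mod_Suc)
    with that c show ?thesis by (auto dest: inj_onD)
  qed
  have ne': "c 0 \<noteq> l" if "l \<in> L" for l
    using that disj k by force
  show "simple_graph V E"
    unfolding simple_graph_def using k L ne ne' by (auto simp: V E)
  show "card V = k + m"
    using L c disj by (simp add: V card_Un_disjoint card_image)
qed

lemma cycle_star_exists:
  assumes "3 \<le> k" and "0 < m"
  shows "\<exists>(V :: nat set) E. cycle_star k m V E"
proof -
  have "inj_on id {..<k}" "finite {k..<k+m}" "card {k..<k+m} = m" "id ` {..<k} \<inter> {k..<k+m} = {}"
    by auto
  with assms show ?thesis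
    unfolding cycle_star_def by blast
qed

end

theory Submission imports Defs
begin

text \<open>
  The labels of the neighbours of a vertex are pairwise distinct, so the strength is at least the
  maximum degree, here \<open>n - 3\<close>; and all weights lie in \<open>{2..2 * k}\<close>, so \<open>k = 3\<close> leaves room for only
  five edges, which excludes it for \<open>n = 6\<close>. For \<open>k = max 4 (n - 3)\<close> label the cycle
  \<open>1, k - 2, k, k, k - 1\<close>, starting at the vertex with the leaves: the three edges away from this
  vertex get the weights \<open>2 * k - 2, 2 * k, 2 * k - 1\<close>, all above \<open>k + 1\<close>, and the leaves can
  take any distinct labels other than \<open>k - 2\<close> and \<open>k - 1\<close>.
\<close>

text \<open>Edges at \<open>u\<close> share the summand \<open>\<phi> u\<close>, so equal labels on
  two neighbours would give equal weights.\<close>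

lemma edge_irregular_labeling_card_neighbours_le:
  assumes "edge_irregular_labeling V E k \<phi>"
    and "S \<subseteq> V" "u \<notin> S" "\<And>v. v \<in> S \<Longrightarrow> {u, v} \<in> E"
  shows "card S \<le> k"
proof -
  have inj: "inj_on (edge_weight \<phi>) E" and lab: "\<phi> ` V \<subseteq> {1..k}"
    using assms(1) by (auto simp: edge_irregular_labeling_def vertex_labeling_def)
  have "inj_on \<phi> S"
  proof (rule inj_onI)
    fix v w assume vw: "v \<in> S" "w \<in> S" "\<phi> v = \<phi> w"
    with assms(3) have "edge_weight \<phi> {u, v} = edge_weight \<phi> {u, w}"
      by (metis edge_weight_doubleton)
    with inj assms(4) vw have "{u, v} = {u, w}"
      by (meson inj_onD)
    then show "v = w"
      by (auto simp: doubleton_eq_iff)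
  qed
  moreover have "\<phi> ` S \<subseteq> {1..k}"
    using lab assms(2) by blast
  ultimately show ?thesis
    using card_inj_on_le[of \<phi> S "{1..k}"] by simp
qed

lemma edge_irregular_labeling_card_edges_le:
  assumes "simple_graph V E" and "edge_irregular_labeling V E k \<phi>"
  shows "card E \<le> 2 * k - 1"
proof -
  have lab: "\<phi> v \<in> {1..k}" if "v \<in> V" for v
    using assms(2) that by (auto simp: edge_irregular_labeling_def vertex_labeling_def)
  have "edge_weight \<phi> e \<in> {2..2 * k}" if "e \<in> E" for e
  proof -
    from that assms(1) have e: "e \<subseteq> V" "card e = 2"
      by (auto simp: simple_graph_def)
    then obtain u v where "e = {u, v}" "u \<noteq> v"
      by (auto simp: card_2_iff)
    with e lab[of u] lab[of v] show ?thesis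
      by (auto simp: edge_weight_doubleton)
  qed
  moreover have "inj_on (edge_weight \<phi>) E"
    using assms(2) by (simp add: edge_irregular_labeling_def)
  ultimately have "card E \<le> card {2..2 * k}"
    by (intro card_inj_on_le) auto
  then show ?thesis by simp
qed

text \<open>Replaces the modular indexing of the cycle by five named vertices, with \<open>a\<close>
  carrying the leaves, so that later claims about the cycle become finite checks.\<close>

lemma cycle_star_5E:
  assumes "cycle_star 5 m V E"
  obtains a b c d e L where "distinct [a, b, c, d, e]" "finite L" "card L = m"
    "L \<inter> {a, b, c, d, e} = {}" "V = {a, b, c, d, e} \<union> L"
    "E = {{a, b}, {b, c}, {c, d}, {d, e}, {e, a}} \<union> (\<lambda>l. {a, l}) ` L"
proof -
  from assms obtain f L where f: "inj_on f {..<5::nat}" and L: "finite L" "card L = m"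
    and disj: "f ` {..<5} \<inter> L = {}" and V: "V = f ` {..<5} \<union> L"
    and E: "E = {{f i, f (Suc i mod 5)} | i. i < 5} \<union> {{f 0, l} | l. l \<in> L}"
    unfolding cycle_star_def by blast
  have five: "{..<5::nat} = {0, 1, 2, 3, 4}"
    by auto
  have "{{f i, f (Suc i mod 5)} | i. i < 5} = (\<lambda>i. {f i, f (Suc i mod 5)}) ` {..<5}"
    by auto
  also have "\<dots> = {{f 0, f 1}, {f 1, f 2}, {f 2, f 3}, {f 3, f 4}, {f 4, f 0}}"
    by (simp add: five flip: numeral_2_eq_2)
  finally have cycle: "{{f i, f (Suc i mod 5)} | i. i < 5} =
    {{f 0, f 1}, {f 1, f 2}, {f 2, f 3}, {f 3, f 4}, {f 4, f 0}}" .
  show ?thesis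
  proof (rule that)
    show "distinct [f 0, f 1, f 2, f 3, f 4]"
      using f by (auto simp: five)
    show "L \<inter> {f 0, f 1, f 2, f 3, f 4} = {}"
      using disj by (auto simp: five)
    show "V = {f 0, f 1, f 2, f 3, f 4} \<union> L"
      by (simp add: V five)
    show "E = {{f 0, f 1}, {f 1, f 2}, {f 2, f 3}, {f 3, f 4}, {f 4, f 0}} \<union> (\<lambda>l. {f 0, l}) ` L"
      by (simp only: E cycle Setcompr_eq_image)
  qed (use L in auto)
qed

lemma cycle_star_5_labeling_ge:
  assumes "cycle_star 5 m V E" and "edge_irregular_labeling V E k \<phi>"
  shows "max 4 (m + 2) \<le> k"
proof -
  from assms(1) have m: "0 < m"
    by (simp add: cycle_star_def)
  from assms(1) obtain a b c d e L where dist: "distinct [a, b, c, d, e]"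
    and L: "finite L" "card L = m" and disj: "L \<inter> {a, b, c, d, e} = {}"
    and V: "V = {a, b, c, d, e} \<union> L"
    and E: "E = {{a, b}, {b, c}, {c, d}, {d, e}, {e, a}} \<union> (\<lambda>l. {a, l}) ` L"
    by (rule cycle_star_5E)
  \<comment> \<open>The neighbours of \<open>a\<close> are its two cycle neighbours and the
    leaves.\<close>
  have "card ({b, e} \<union> L) \<le> k"
    by (rule edge_irregular_labeling_card_neighbours_le[OF assms(2), where u = a])
      (use dist disj in \<open>auto simp: V E insert_commute\<close>)
  moreover have "card ({b, e} \<union> L) = m + 2"
    using L disj dist by (subst card_Un_disjoint) auto
  ultimately have "m + 2 \<le> k" by simp
  moreover have "4 \<le> k"
  proof -
    from m L obtain l where l: "l \<in> L"
      by (metis card.empty ex_in_conv less_irrefl)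
    \<comment> \<open>One leaf edge besides the cycle suffices: six edges give 6 \<le> 2 * k - 1,
      and by integrality 4 \<le> k.\<close>
    let ?F = "{{a, b}, {b, c}, {c, d}, {d, e}, {e, a}, {a, l}}"
    have "card ?F = 6"
      using dist disj l by (auto simp: card_insert_if doubleton_eq_iff)
    moreover have "card ?F \<le> card E"
      using L l by (intro card_mono) (auto simp: E)
    moreover have "card E \<le> 2 * k - 1"
      by (rule edge_irregular_labeling_card_edges_le[OF cycle_star_simple_graph(1)[OF assms(1)] assms(2)])
    ultimately show ?thesis by simp
  qed
  ultimately show ?thesis by simp
qed

lemma cycle_star_5_labeling_exists:
  assumes "cycle_star 5 m V E"
  shows "\<exists>\<phi>. edge_irregular_labeling V E (max 4 (m + 2)) \<phi>"
proof -
  from assms obtain a b c d e L where dist: "distinct [a, b, c, d, e]"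
    and L: "finite L" "card L = m" and disj: "L \<inter> {a, b, c, d, e} = {}"
    and V: "V = {a, b, c, d, e} \<union> L"
    and E: "E = {{a, b}, {b, c}, {c, d}, {d, e}, {e, a}} \<union> (\<lambda>l. {a, l}) ` L"
    by (rule cycle_star_5E)
  define k where "k = max 4 (m + 2)"
  have k: "4 \<le> k" by (simp add: k_def)
  \<comment> \<open>As \<open>a\<close> gets label 1, the edges at \<open>a\<close> have distinct
    weights iff its neighbours have distinct labels; \<open>k - 2\<close> and \<open>k - 1\<close>
    are reserved for \<open>b\<close> and \<open>e\<close>. The remaining \<open>k - 2\<close>
    labels suffice because m + 2 \<le> k, and for m \<ge> 2 the leaves use all of them.\<close>
  have "card ({1..k} - {k - 2, k - 1}) = k - 2"
    using k by (subst card_Diff_subset) auto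
  then have "card L \<le> card ({1..k} - {k - 2, k - 1})"
    using L by (simp add: k_def)
  then obtain g where g: "g ` L \<subseteq> {1..k} - {k - 2, k - 1}" "inj_on g L"
    using L card_le_inj[of L "{1..k} - {k - 2, k - 1}"] by auto
  define \<phi> where "\<phi> = g(a := 1, b := k - 2, c := k, d := k, e := k - 1)"
  have cyc: "\<phi> a = 1" "\<phi> b = k - 2" "\<phi> c = k" "\<phi> d = k" "\<phi> e = k - 1"
    using dist by (auto simp: \<phi>_def)
  have leaf: "\<phi> l = g l" "l \<noteq> a" if "l \<in> L" for l
    using that disj by (auto simp: \<phi>_def)
  have range: "1 \<le> g l" "g l \<le> k" "g l \<noteq> k - 2" "g l \<noteq> k - 1" if "l \<in> L" for l
    using that g by auto
  have w: "edge_weight \<phi> {a, b} = k - 1" "edge_weight \<phi> {b, c} = 2 * k - 2"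
    "edge_weight \<phi> {c, d} = 2 * k" "edge_weight \<phi> {d, e} = 2 * k - 1" "edge_weight \<phi> {e, a} = k"
    using dist k by (auto simp: edge_weight_doubleton cyc)
  have wl: "edge_weight \<phi> {a, l} = Suc (g l)" if "l \<in> L" for l
    using leaf[OF that] by (simp add: edge_weight_doubleton cyc)
  define C where "C = {{a, b}, {b, c}, {c, d}, {d, e}, {e, a}}"
  have "inj_on (edge_weight \<phi>) ((\<lambda>l. {a, l}) ` L)"
    using g(2) by (auto simp: inj_on_def wl)
  moreover have "inj_on (edge_weight \<phi>) C"
    using k by (auto simp: C_def w)
  moreover have "edge_weight \<phi> ` C \<inter> edge_weight \<phi> ` (\<lambda>l. {a, l}) ` L = {}"
  proof -
    \<comment> \<open>The two excluded labels keep leaf weights off \<open>k - 1\<close> and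
      \<open>k\<close>. The other cycle weights are at least \<open>2 * k - 2\<close>, which exceeds
      the largest possible leaf weight \<open>k + 1\<close> precisely when 4 \<le> k.\<close>
    have "Suc (g l) \<notin> edge_weight \<phi> ` C" if "l \<in> L" for l
      using range[OF that] k by (auto simp: C_def w)
    then show ?thesis
      by (force simp: wl)
  qed
  ultimately have "inj_on (edge_weight \<phi>) (C \<union> (\<lambda>l. {a, l}) ` L)"
    unfolding inj_on_Un by blast
  then have "inj_on (edge_weight \<phi>) E"
    by (simp only: E C_def)
  moreover have "vertex_labeling V k \<phi>"
    using k leaf(1) range(1,2) by (auto simp: vertex_labeling_def V cyc)
  ultimately show ?thesis
    unfolding edge_irregular_labeling_def k_def by blast
qed

text \<open>One formula for both cases: with m = n - 5 the maximum is 4 = n - 2 at n = 6, and m + 2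
  = n - 3 from n = 7 on.\<close>

lemma edge_irregularity_strength_cycle_star_5:
  assumes "cycle_star 5 m V E"
  shows "edge_irregularity_strength V E = max 4 (m + 2)"
  unfolding edge_irregularity_strength_def
  using cycle_star_5_labeling_exists[OF assms] cycle_star_5_labeling_ge[OF assms]
  by (intro Least_equality) auto

theorem theorem3p4:
  fixes n :: nat and V :: "'a set" and E :: "'a set set"
  assumes "6 \<le> n"
    and "cycle_star 5 (n - 5) V E"
  shows "(n = 6 \<longrightarrow> edge_irregularity_strength V E = n - 2) \<and>
         (7 \<le> n \<longrightarrow> edge_irregularity_strength V E = n - 3)"
  using edge_irregularity_strength_cycle_star_5[OF assms(2)] by auto

end
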